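(* Let $\mathscr T=(V,E)$ be a leafless, rooted directed tree with root $\mathsf{root}$ and let $\mathscr T_\infty$ be the extended directed tree associated with $\mathscr T$, with vertex set $V_\infty=V\sqcup\{\infty\}$. For $u\in V$, $b\in V\setminus\{u\}$ and a weight system $\lambda_u=\{\lambda_{uv}\}_{v\in V_\infty}$ of complex numbers, let $W^{(b)}_{\lambda_u}$ denote the weighted join operator on $\mathscr T$. If there exists a branching vertex $w\in\mathsf{Asc}(u)$, then $W^{(b)}_{\lambda_u}$ has a large null summand.
   Context: Trees. A directed tree $\mathscr T=(V,E)$ is a directed graph (no loops, $V$ and $E$ nonempty) which has no circuits, is connected (ignoring orientation), and in which every non-root vertex $v$ has exactly one parent $\mathsf{par}(v)$; a root is a vertex with no parent, and $\mathscr T$ is rooted if it has a unique root $\mathsf{root}$. Throughout $\mathrm{card}(V)=\aleph_0$. It is leafless if every vertex has at least one child; a branching vertex is a vertex with at least two children. $\mathsf{Des}(u)$ is the set of descendants of $u$, including $u$; $\mathsf{Asc}(u)=\{\mathsf{par}^{\langle n\rangle}(u):n\ge1\}$. The depth of $u$ is the length of the directed path from $\mathsf{root}$ to $u$. Join operations. The extended tree has vertex set $V_\infty=V\sqcup\{\infty\}$ with $\infty$ declared a child (hence a descendant) of every $v\in V$. For $u,v\in V_\infty$: $u\sqcup v=u$ if $u\in\mathsf{Des}(v)$; $=v$ if $v\in\mathsf{Des}(u)$; $=\infty$ otherwise. For $u,v\in V$, $u\sqcap v$ is the vertex of largest depth among $\{w\in V:\mathsf{par}^{\langle n\rangle}(u)=w=\mathsf{par}^{\langle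 m\rangle}(v)\text{ for some }m,n\ge0\}$. For $b\in V$: $u\sqcup_bv=u\sqcap v$ if $u,v\in\mathsf{Asc}(b)$; $=u$ if $v=b$; $=v$ if $u=b$; $=u\sqcup v$ otherwise. Operators. A weight system is a family $\{\lambda_{uv}\}_{v\in V_\infty}\subseteq\mathbb C$ with $\lambda_{u\infty}=0$. $W^{(b)}_{\lambda_u}$ is the operator in $\ell^2(V)$ with domain $\{f\in\ell^2(V):\Lambda^{(b)}_uf\in\ell^2(V)\}$ and $W^{(b)}_{\lambda_u}f=\Lambda^{(b)}_uf$, where $(\Lambda^{(b)}_uf)(w)=\sum_{v\in V:\,u\sqcup_bv=w}\lambda_{uv}f(v)$, $w\in V$. A densely defined linear operator $T$ in $\mathcal H$ has (admits) a large null summand if it has an infinite dimensional reducing subspace contained in its kernel; a closed subspace $\mathcal M$ is reducing for $T$ if $T=T_0\oplus T_1$ with linear operators $T_0$ in $\mathcal M$ and $T_1$ in $\mathcal M^\perp$. *)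

theory Defs
  imports "HOL-Analysis.Analysis" "HOL-Library.Function_Algebras"
begin

section \<open>Directed trees\<close>

text \<open>\<open>acyclic\<close> also excludes loops, and \<open>E \<noteq> {}\<close> together with \<open>E \<subseteq> V \<times> V\<close> makes \<open>V\<close> nonempty.
  The last condition says that a vertex that has a parent has only one.\<close>

definition directed_tree :: "'a set \<Rightarrow> ('a \<times> 'a) set \<Rightarrow> bool" where
  "directed_tree V E \<longleftrightarrow>
     E \<subseteq> V \<times> V \<and> E \<noteq> {} \<and> acyclic E \<and>
     (\<forall>u\<in>V. \<forall>v\<in>V. (u, v) \<in> (E \<union> E\<inverse>)\<^sup>*) \<and>
     (\<forall>v\<in>V. (\<exists>u. (u, v) \<in> E) \<longrightarrow> (\<exists>!u. (u, v) \<in> E))"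

definition is_root :: "'a set \<Rightarrow> ('a \<times> 'a) set \<Rightarrow> 'a \<Rightarrow> bool" where
  "is_root V E r \<longleftrightarrow> r \<in> V \<and> (\<nexists>u. (u, r) \<in> E)"

definition rooted :: "'a set \<Rightarrow> ('a \<times> 'a) set \<Rightarrow> bool" where
  "rooted V E \<longleftrightarrow> (\<exists>!r. is_root V E r)"

definition tree_root :: "'a set \<Rightarrow> ('a \<times> 'a) set \<Rightarrow> 'a" where
  "tree_root V E = (THE r. is_root V E r)"

definition leafless :: "'a set \<Rightarrow> ('a \<times> 'a) set \<Rightarrow> bool" where
  "leafless V E \<longleftrightarrow> (\<forall>u\<in>V. \<exists>v. (u, v) \<in> E)"

definition branching_vertex :: "'a set \<Rightarrow> ('a \<times> 'a) set \<Rightarrow> 'a \<Rightarrow> bool" where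
  "branching_vertex V E w \<longleftrightarrow> w \<in> V \<and> (\<exists>v v'. v \<noteq> v' \<and> (w, v) \<in> E \<and> (w, v') \<in> E)"

text \<open>The parent is a partial function: \<open>None\<close> for the root.\<close>

definition par :: "('a \<times> 'a) set \<Rightarrow> 'a \<Rightarrow> 'a option" where
  "par E v = (if \<exists>!u. (u, v) \<in> E then Some (THE u. (u, v) \<in> E) else None)"

definition par_iter :: "('a \<times> 'a) set \<Rightarrow> nat \<Rightarrow> 'a \<Rightarrow> 'a option" where
  "par_iter E n v = ((\<lambda>x. Option.bind x (par E)) ^^ n) (Some v)"

definition Des :: "('a \<times> 'a) set \<Rightarrow> 'a \<Rightarrow> 'a set" where
  "Des E u = {v. (u, v) \<in> E\<^sup>*}"

definition Asc :: "('a \<times> 'a) set \<Rightarrow> 'a \<Rightarrow> 'a set" where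
  "Asc E u = {w. \<exists>n\<ge>1. par_iter E n u = Some w}"

definition depth :: "'a set \<Rightarrow> ('a \<times> 'a) set \<Rightarrow> 'a \<Rightarrow> nat" where
  "depth V E u = (THE n. (tree_root V E, u) \<in> E ^^ n)"


section \<open>The extended tree and the join operations\<close>

text \<open>The extended vertex set is modelled inside \<open>'a option\<close>, with \<open>None\<close> for \<open>\<infinity>\<close>.\<close>

definition ext_edges :: "'a set \<Rightarrow> ('a \<times> 'a) set \<Rightarrow> ('a option \<times> 'a option) set" where
  "ext_edges V E = {(Some u, Some v) |u v. (u, v) \<in> E} \<union> {(Some v, None) |v. v \<in> V}"

definition join :: "'a set \<Rightarrow> ('a \<times> 'a) set \<Rightarrow> 'a option \<Rightarrow> 'a option \<Rightarrow> 'a option" where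
  "join V E u v =
     (if u \<in> Des (ext_edges V E) v then u
      else if v \<in> Des (ext_edges V E) u then v
      else None)"

definition meet :: "'a set \<Rightarrow> ('a \<times> 'a) set \<Rightarrow> 'a \<Rightarrow> 'a \<Rightarrow> 'a" where
  "meet V E u v =
     (ARG_MAX (depth V E) w.
        w \<in> V \<and> (\<exists>n m. par_iter E n u = Some w \<and> par_iter E m v = Some w))"

definition join_at ::
    "'a set \<Rightarrow> ('a \<times> 'a) set \<Rightarrow> 'a \<Rightarrow> 'a option \<Rightarrow> 'a option \<Rightarrow> 'a option" where
  "join_at V E b u v =
     (if u \<in> Some ` Asc E b \<and> v \<in> Some ` Asc E b then Some (meet V E (the u) (the v))
      else if v = Some b then u
      else if u = Some b then v
      else join V E u v)"


section \<open>The Hilbert space of square summable functions on \<open>V\<close>\<close>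

text \<open>Functions on \<open>V\<close> are represented by functions on the whole type that vanish off \<open>V\<close>.\<close>

global_interpretation cfun: vector_space "\<lambda>(c::complex) (f::'a \<Rightarrow> complex) x. c * f x"
  defines cfun_subspace = cfun.subspace and cfun_span = cfun.span
  by unfold_locales (auto simp: fun_eq_iff algebra_simps)

definition ell2 :: "'a set \<Rightarrow> ('a \<Rightarrow> complex) set" where
  "ell2 V = {f. (\<forall>v. v \<notin> V \<longrightarrow> f v = 0) \<and> (\<lambda>v. (cmod (f v))\<^sup>2) summable_on V}"

definition ell2_inner :: "'a set \<Rightarrow> ('a \<Rightarrow> complex) \<Rightarrow> ('a \<Rightarrow> complex) \<Rightarrow> complex" where
  "ell2_inner V f g = (\<Sum>\<^sub>\<infinity>v\<in>V. f v * cnj (g v))"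

definition ell2_norm :: "'a set \<Rightarrow> ('a \<Rightarrow> complex) \<Rightarrow> real" where
  "ell2_norm V f = sqrt (\<Sum>\<^sub>\<infinity>v\<in>V. (cmod (f v))\<^sup>2)"

definition ell2_dist :: "'a set \<Rightarrow> ('a \<Rightarrow> complex) \<Rightarrow> ('a \<Rightarrow> complex) \<Rightarrow> real" where
  "ell2_dist V f g = ell2_norm V (f - g)"

lemma ell2_norm_add:
  assumes "f \<in> ell2 V" "g \<in> ell2 V"
  shows "f + g \<in> ell2 V" "ell2_norm V (f + g) \<le> ell2_norm V f + ell2_norm V g"
proof -
  have le: "L2_set (\<lambda>v. cmod (h v)) F \<le> ell2_norm V h"
    if "h \<in> ell2 V" "finite F" "F \<subseteq> V" for h F
    using that unfolding L2_set_def ell2_norm_def ell2_def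
    by (auto intro!: finite_sum_le_infsum)
  have bd: "(\<Sum>v\<in>F. (cmod ((f + g) v))\<^sup>2) \<le> (ell2_norm V f + ell2_norm V g)\<^sup>2"
    if F: "finite F" "F \<subseteq> V" for F
  proof -
    have "L2_set (\<lambda>v. cmod ((f + g) v)) F \<le> L2_set (\<lambda>v. cmod (f v) + cmod (g v)) F"
      by (rule L2_set_mono) (auto simp: norm_triangle_ineq)
    also have "\<dots> \<le> L2_set (\<lambda>v. cmod (f v)) F + L2_set (\<lambda>v. cmod (g v)) F"
      by (rule L2_set_triangle_ineq)
    also have "\<dots> \<le> ell2_norm V f + ell2_norm V g"
      by (intro add_mono le assms F)
    finally have "sqrt (\<Sum>v\<in>F. (cmod ((f + g) v))\<^sup>2) \<le> ell2_norm V f + ell2_norm V g"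
      by (simp add: L2_set_def)
    then show ?thesis by (rule sqrt_le_D)
  qed
  have s: "(\<lambda>v. (cmod ((f + g) v))\<^sup>2) summable_on V"
    by (rule nonneg_bdd_above_summable_on, simp,
        rule bdd_aboveI2[where M = "(ell2_norm V f + ell2_norm V g)\<^sup>2"], rule bd) auto
  then show "f + g \<in> ell2 V" using assms by (auto simp: ell2_def)
  have "(\<Sum>\<^sub>\<infinity>v\<in>V. (cmod ((f + g) v))\<^sup>2) \<le> (ell2_norm V f + ell2_norm V g)\<^sup>2"
    by (rule infsum_le_finite_sums[OF s]) (rule bd)
  moreover have "0 \<le> ell2_norm V f + ell2_norm V g"
    by (simp add: ell2_norm_def infsum_nonneg)
  ultimately show "ell2_norm V (f + g) \<le> ell2_norm V f + ell2_norm V g"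
    unfolding ell2_norm_def[of V "f + g"] by (rule real_le_lsqrt[rotated])
qed

lemma ell2_scale: "f \<in> ell2 V \<Longrightarrow> (\<lambda>v. c * f v) \<in> ell2 V"
  by (auto simp: ell2_def norm_mult power_mult_distrib intro: summable_on_cmult_right)

lemma ell2_diff:
  assumes "f \<in> ell2 V" "g \<in> ell2 V"
  shows "f - g \<in> ell2 V"
proof -
  have "f - g = f + (\<lambda>v. (-1) * g v)" by (auto simp: fun_eq_iff)
  then show ?thesis using ell2_norm_add(1)[OF assms(1) ell2_scale[OF assms(2)]] by metis
qed

lemma ell2_Metric_space: "Metric_space (ell2 V) (ell2_dist V)"
proof
  fix f g h :: "'a \<Rightarrow> complex"
  show "0 \<le> ell2_dist V f g"
    by (simp add: ell2_dist_def ell2_norm_def infsum_nonneg)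
  show "ell2_dist V f g = ell2_dist V g f"
    by (simp add: ell2_dist_def ell2_norm_def norm_minus_commute)
  assume fg: "f \<in> ell2 V" "g \<in> ell2 V"
  show "ell2_dist V f g = 0 \<longleftrightarrow> f = g"
  proof
    assume "ell2_dist V f g = 0"
    then have z: "(\<Sum>\<^sub>\<infinity>v\<in>V. (cmod ((f - g) v))\<^sup>2) = 0"
      by (simp add: ell2_dist_def ell2_norm_def)
    have s: "(\<lambda>v. (cmod ((f - g) v))\<^sup>2) summable_on V"
      using ell2_diff[OF fg] by (simp add: ell2_def)
    have "(cmod ((f - g) v))\<^sup>2 = 0" if "v \<in> V" for v
      by (rule nonneg_infsum_le_0D[OF eq_refl[OF z] s _ that]) simp
    then show "f = g" using fg by (simp add: ell2_def fun_eq_iff) metis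
  qed (simp add: ell2_dist_def ell2_norm_def)
  assume h: "h \<in> ell2 V"
  show "ell2_dist V f h \<le> ell2_dist V f g + ell2_dist V g h"
    using ell2_norm_add(2)[OF ell2_diff[OF fg] ell2_diff[OF fg(2) h]]
    by (simp add: ell2_dist_def)
qed

definition ell2_topology :: "'a set \<Rightarrow> ('a \<Rightarrow> complex) topology" where
  "ell2_topology V = Metric_space.mtopology (ell2 V) (ell2_dist V)"

definition orth_compl :: "'a set \<Rightarrow> ('a \<Rightarrow> complex) set \<Rightarrow> ('a \<Rightarrow> complex) set" where
  "orth_compl V M = {g \<in> ell2 V. \<forall>f\<in>M. ell2_inner V f g = 0}"

definition infinite_dimensional :: "('a \<Rightarrow> complex) set \<Rightarrow> bool" where
  "infinite_dimensional M \<longleftrightarrow> (\<nexists>B. finite B \<and> M \<subseteq> cfun.span B)"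


section \<open>Unbounded operators\<close>

text \<open>An operator is a domain together with a map. The values of the map off the domain carry no
  meaning, so operators must not be compared with HOL equality.\<close>

datatype 'h operator = Operator (op_dom: "'h set") (op_app: "'h \<Rightarrow> 'h")

text \<open>Linear operators in a subspace \<open>H\<close>: domain and range are contained in \<open>H\<close>.\<close>

definition linear_operator_in ::
    "('a \<Rightarrow> complex) set \<Rightarrow> ('a \<Rightarrow> complex) operator \<Rightarrow> bool" where
  "linear_operator_in H T \<longleftrightarrow>
     op_dom T \<subseteq> H \<and> op_app T ` op_dom T \<subseteq> H \<and> cfun.subspace (op_dom T) \<and>
     (\<forall>f\<in>op_dom T. \<forall>g\<in>op_dom T. op_app T (f + g) = op_app T f + op_app T g) \<and>
     (\<forall>c. \<forall>f\<in>op_dom T. op_app T (\<lambda>v. c * f v) = (\<lambda>v. c * op_app T f v))"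

definition densely_defined :: "'a set \<Rightarrow> ('a \<Rightarrow> complex) operator \<Rightarrow> bool" where
  "densely_defined V T \<longleftrightarrow> ell2_topology V closure_of op_dom T = ell2 V"

definition op_kernel :: "('a \<Rightarrow> complex) operator \<Rightarrow> ('a \<Rightarrow> complex) set" where
  "op_kernel T = {f \<in> op_dom T. op_app T f = 0}"

text \<open>\<open>T = T0 \<oplus> T1\<close>, where \<open>T0\<close> and \<open>T1\<close> act in mutually orthogonal subspaces.\<close>

definition is_orth_sum ::
    "('a \<Rightarrow> complex) operator \<Rightarrow> ('a \<Rightarrow> complex) operator \<Rightarrow> ('a \<Rightarrow> complex) operator \<Rightarrow> bool" where
  "is_orth_sum T T0 T1 \<longleftrightarrow>
     op_dom T = {f + g |f g. f \<in> op_dom T0 \<and> g \<in> op_dom T1} \<and>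
     (\<forall>f\<in>op_dom T0. \<forall>g\<in>op_dom T1. op_app T (f + g) = op_app T0 f + op_app T1 g)"

definition reducing_subspace ::
    "'a set \<Rightarrow> ('a \<Rightarrow> complex) operator \<Rightarrow> ('a \<Rightarrow> complex) set \<Rightarrow> bool" where
  "reducing_subspace V T M \<longleftrightarrow>
     cfun.subspace M \<and> closedin (ell2_topology V) M \<and>
     (\<exists>T0 T1. linear_operator_in M T0 \<and> linear_operator_in (orth_compl V M) T1 \<and>
        is_orth_sum T T0 T1)"

text \<open>The notion presupposes a densely defined linear operator; this is part of the predicate.\<close>

definition has_large_null_summand :: "'a set \<Rightarrow> ('a \<Rightarrow> complex) operator \<Rightarrow> bool" where
  "has_large_null_summand V T \<longleftrightarrow>
     linear_operator_in (ell2 V) T \<and> densely_defined V T \<and>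
     (\<exists>M. reducing_subspace V T M \<and> infinite_dimensional M \<and> M \<subseteq> op_kernel T)"


section \<open>Weighted join operators\<close>

text \<open>The weight system \<open>\<lambda>\<^sub>u\<close> is a function \<open>l\<close> on \<open>V \<union> {\<infinity>}\<close>; its values elsewhere play no role.\<close>

definition weight_system :: "('a option \<Rightarrow> complex) \<Rightarrow> bool" where
  "weight_system l \<longleftrightarrow> l None = 0"

text \<open>In a rooted directed tree, for \<open>u \<in> V\<close> and \<open>b \<in> V\<close>, the index set of the sum is contained in
  the finite set \<open>{w, b} \<union> Asc E u \<union> Asc E b\<close>, so no question of convergence arises.\<close>

definition Lambda_join ::
    "'a set \<Rightarrow> ('a \<times> 'a) set \<Rightarrow> 'a \<Rightarrow> 'a \<Rightarrow> ('a option \<Rightarrow> complex) \<Rightarrow> ('a \<Rightarrow> complex) \<Rightarrow> ('a \<Rightarrow> complex)"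
  where
  "Lambda_join V E b u l f =
     (\<lambda>w. if w \<in> V
          then \<Sum>\<^sub>\<infinity>v\<in>{v \<in> V. join_at V E b (Some u) (Some v) = Some w}. l (Some v) * f v
          else 0)"

definition weighted_join_operator ::
    "'a set \<Rightarrow> ('a \<times> 'a) set \<Rightarrow> 'a \<Rightarrow> 'a \<Rightarrow> ('a option \<Rightarrow> complex) \<Rightarrow> ('a \<Rightarrow> complex) operator" where
  "weighted_join_operator V E b u l =
     Operator {f \<in> ell2 V. Lambda_join V E b u l f \<in> ell2 V} (Lambda_join V E b u l)"

end

theory Submission
  imports Defs
begin

text \<open>Call two vertices comparable if one is a descendant of the other. The join at \<open>b\<close> of \<open>u\<close> with
  a vertex \<open>v \<noteq> b\<close> that is not comparable to \<open>u\<close> is \<open>\<infinity>\<close>, so such a \<open>v\<close> contributes to none of the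
  sums that define \<open>W\<close>. Every finite value of the join at \<open>b\<close> with \<open>u\<close> is comparable to \<open>u\<close>
  (\<open>join_at_SomeD\<close>), so \<open>W f\<close> always vanishes at the vertices that are not comparable to \<open>u\<close>. Let
  \<open>N\<close> be the set of vertices other than \<open>b\<close> that are not comparable to \<open>u\<close>. The operator neither
  reads nor writes the coordinates in \<open>N\<close>. The functions supported on \<open>N\<close> therefore form a reducing
  subspace inside the kernel, whose dimension is infinite as soon as \<open>N\<close> is infinite
  (\<open>large_null_summand_fibre_operator\<close>).

  The branching ancestor makes \<open>N\<close> infinite: it has a child off the path to \<open>u\<close>, no vertex below that
  child is comparable to \<open>u\<close>, and in a leafless tree there are infinitely many of them
  (\<open>infinite_incomparable\<close>).

  Linearity and dense domain hold for every summation over the fibres of a partial map with finite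
  fibres. The fibres of the join are finite because a vertex of a rooted tree has only finitely many
  ancestors (\<open>finite_ancestors\<close>).\<close>


section \<open>Square summable functions\<close>

lemma ell2_support_subset:
  assumes "f \<in> ell2 V"
  shows "(\<lambda>v. if v \<in> A then f v else 0) \<in> ell2 V"
proof -
  have "(\<lambda>v. (cmod (if v \<in> A then f v else 0))\<^sup>2) summable_on V"
    by (rule summable_on_comparison_test[where f = "\<lambda>v. (cmod (f v))\<^sup>2"])
      (use assms in \<open>auto simp: ell2_def\<close>)
  then show ?thesis using assms by (auto simp: ell2_def)
qed

lemma ell2_finite_support:
  assumes "finite F" "\<And>v. f v \<noteq> 0 \<Longrightarrow> v \<in> F \<inter> V"
  shows "f \<in> ell2 V"
proof -
  have "finite {v \<in> V. (cmod (f v))\<^sup>2 \<noteq> 0}"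
    by (rule finite_subset[OF _ assms(1)]) (use assms(2) in auto)
  then have "(\<lambda>v. (cmod (f v))\<^sup>2) summable_on V"
    by (rule finite_nonzero_values_imp_summable_on)
  then show ?thesis using assms(2) by (auto simp: ell2_def)
qed

lemma subspace_ell2: "cfun.subspace (ell2 V)"
proof (rule cfun.subspaceI)
  show "0 \<in> ell2 V" by (rule ell2_finite_support[of "{}"]) auto
qed (auto intro: ell2_norm_add ell2_scale)

lemma cmod_le_ell2_norm:
  assumes "f \<in> ell2 V"
  shows "cmod (f v) \<le> ell2_norm V f"
proof (cases "v \<in> V")
  case True
  have "(\<Sum>x\<in>{v}. (cmod (f x))\<^sup>2) \<le> (\<Sum>\<^sub>\<infinity>x\<in>V. (cmod (f x))\<^sup>2)"
    by (rule finite_sum_le_infsum) (use assms True in \<open>auto simp: ell2_def\<close>)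
  then show ?thesis unfolding ell2_norm_def by (intro real_le_rsqrt) auto
next
  case False
  then show ?thesis using assms by (auto simp: ell2_def ell2_norm_def infsum_nonneg)
qed

text \<open>The tails of a convergent sum of squares tend to zero, so truncating a square summable
  function to a large finite set changes it by little in norm.\<close>

lemma dense_if_contains_finite_support:
  assumes D: "D \<subseteq> ell2 V"
    and fin: "\<And>f F. f \<in> ell2 V \<Longrightarrow> finite F \<Longrightarrow> (\<And>v. f v \<noteq> 0 \<Longrightarrow> v \<in> F) \<Longrightarrow> f \<in> D"
  shows "ell2_topology V closure_of D = ell2 V"
proof -
  interpret Metric_space "ell2 V" "ell2_dist V" by (rule ell2_Metric_space)
  have "\<exists>g\<in>D. g \<in> mball f r" if f: "f \<in> ell2 V" and r: "r > 0" for f r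
  proof -
    let ?q = "\<lambda>v. (cmod (f v))\<^sup>2"
    have s: "?q summable_on V" using f by (simp add: ell2_def)
    have "r\<^sup>2 / 2 > 0" using r by simp
    then obtain F where F: "finite F" "F \<subseteq> V" "dist (sum ?q F) (infsum ?q V) \<le> r\<^sup>2 / 2"
      using has_sum_finite_approximation[OF has_sum_infsum[OF s]] by blast
    define g where "g = (\<lambda>v. if v \<in> F then f v else 0)"
    have g: "g \<in> ell2 V" unfolding g_def by (rule ell2_support_subset[OF f])
    have gD: "g \<in> D" by (rule fin[OF g F(1)]) (auto simp: g_def split: if_splits)
    have "(\<Sum>\<^sub>\<infinity>v\<in>V. (cmod ((f - g) v))\<^sup>2) = infsum ?q (V - F)"
      by (rule infsum_cong_neutral) (use F(2) in \<open>auto simp: g_def\<close>)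
    also have "\<dots> = infsum ?q V - sum ?q F"
      using infsum_Diff[OF s summable_on_finite[OF F(1)] F(2)] F(1) by simp
    also have "\<dots> \<le> r\<^sup>2 / 2" using F(3) unfolding dist_real_def by linarith
    also have "\<dots> < r\<^sup>2" using r by simp
    finally have "ell2_dist V f g < sqrt (r\<^sup>2)"
      unfolding ell2_dist_def ell2_norm_def by (rule real_sqrt_less_mono)
    then have "ell2_dist V f g < r" using r by simp
    then show ?thesis using f g gD by auto
  qed
  then show ?thesis
    unfolding ell2_topology_def metric_closure_of by auto
qed

definition supported_on :: "'a set \<Rightarrow> 'a set \<Rightarrow> ('a \<Rightarrow> complex) set" where
  "supported_on V N = {f \<in> ell2 V. \<forall>v. v \<notin> N \<longrightarrow> f v = 0}"

lemma subspace_supported_on: "cfun.subspace (supported_on V N)"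
  using subspace_ell2[of V]
  by (intro cfun.subspaceI)
    (auto simp: supported_on_def cfun.subspace_0 intro: ell2_norm_add ell2_scale)

text \<open>Evaluation at a point is continuous, being bounded by the norm.\<close>

lemma closedin_supported_on: "closedin (ell2_topology V) (supported_on V N)"
proof -
  interpret Metric_space "ell2 V" "ell2_dist V" by (rule ell2_Metric_space)
  have "\<exists>r>0. disjnt (supported_on V N) (mball f r)" if nf: "f \<in> ell2 V - supported_on V N" for f
  proof -
    obtain v where v: "v \<notin> N" "f v \<noteq> 0" and f: "f \<in> ell2 V"
      using nf unfolding supported_on_def by blast
    have "cmod (f v) \<le> ell2_dist V f g" if "g \<in> supported_on V N" for g
      using cmod_le_ell2_norm[OF ell2_diff[OF f], of g v] that v(1)
      by (simp add: supported_on_def ell2_dist_def)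
    then show ?thesis
      by (intro exI[of _ "cmod (f v)"]) (use v in \<open>force simp: disjnt_iff\<close>)
  qed
  then show ?thesis
    unfolding ell2_topology_def closedin_metric by (auto simp: supported_on_def)
qed

definition point_mass :: "'a \<Rightarrow> 'a \<Rightarrow> complex" where
  "point_mass v = (\<lambda>x. if x = v then 1 else 0)"

lemma point_mass_supported_on:
  assumes "v \<in> N" "N \<subseteq> V"
  shows "point_mass v \<in> supported_on V N"
proof -
  have "point_mass v \<in> ell2 V"
    by (rule ell2_finite_support[of "{v}"]) (use assms in \<open>auto simp: point_mass_def split: if_splits\<close>)
  then show ?thesis using assms by (auto simp: supported_on_def point_mass_def)
qed

lemma orth_compl_supported_on:
  assumes "N \<subseteq> V"
  shows "orth_compl V (supported_on V N) = supported_on V (V - N)"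
proof (intro set_eqI iffI)
  fix g assume g: "g \<in> orth_compl V (supported_on V N)"
  have "g v = 0" if "v \<in> N" for v
  proof -
    have "ell2_inner V (point_mass v) g = (\<Sum>\<^sub>\<infinity>x\<in>{v}. cnj (g v))"
      unfolding ell2_inner_def
      by (rule infsum_cong_neutral) (use that assms in \<open>auto simp: point_mass_def\<close>)
    then show ?thesis
      using g point_mass_supported_on[OF that assms] by (auto simp: orth_compl_def)
  qed
  then show "g \<in> supported_on V (V - N)"
    using g by (auto simp: orth_compl_def supported_on_def ell2_def)
next
  fix g assume g: "g \<in> supported_on V (V - N)"
  have "ell2_inner V f g = 0" if "f \<in> supported_on V N" for f
    unfolding ell2_inner_def
    by (rule infsum_0) (use that g in \<open>auto simp: supported_on_def\<close>)
  then show "g \<in> orth_compl V (supported_on V N)"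
    using g by (auto simp: orth_compl_def supported_on_def)
qed

text \<open>The point masses of the points of \<open>N\<close> are linearly independent, because a combination of the
  others vanishes where a given one takes the value one.\<close>

lemma infinite_dimensional_supported_on:
  assumes "infinite N" "N \<subseteq> V"
  shows "infinite_dimensional (supported_on V N)"
proof -
  have inj: "inj_on point_mass N"
    by (rule inj_onI) (metis point_mass_def zero_neq_one)
  have ind: "cfun.independent (point_mass ` N)"
    unfolding cfun.dependent_def
  proof clarify
    fix v assume v: "v \<in> N" and sp: "point_mass v \<in> cfun.span (point_mass ` N - {point_mass v})"
    have "cfun.span (point_mass ` N - {point_mass v}) \<subseteq> {f. f v = 0}"
    proof (rule cfun.span_minimal)
      show "cfun.subspace {f. f v = 0}" by (rule cfun.subspaceI) auto
    qed (auto simp: point_mass_def)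
    with sp show False by (auto simp: point_mass_def)
  qed
  show ?thesis unfolding infinite_dimensional_def
  proof clarify
    fix B assume B: "finite B" "supported_on V N \<subseteq> cfun.span B"
    have "point_mass ` N \<subseteq> cfun.span B"
      using B(2) point_mass_supported_on[OF _ assms(2)] by auto
    then have "finite (point_mass ` N)"
      using cfun.independent_span_bound[OF B(1) ind] by simp
    then show False using finite_imageD[OF _ inj] assms(1) by blast
  qed
qed


section \<open>Summation over the fibres of a partial map\<close>

definition fibre_sum ::
    "'a set \<Rightarrow> ('a \<Rightarrow> 'a option) \<Rightarrow> ('a \<Rightarrow> complex) \<Rightarrow> ('a \<Rightarrow> complex) \<Rightarrow> 'a \<Rightarrow> complex" where
  "fibre_sum V \<phi> k f =
     (\<lambda>w. if w \<in> V then \<Sum>\<^sub>\<infinity>v\<in>{v \<in> V. \<phi> v = Some w}. k v * f v else 0)"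

definition fibre_operator ::
    "'a set \<Rightarrow> ('a \<Rightarrow> 'a option) \<Rightarrow> ('a \<Rightarrow> complex) \<Rightarrow> ('a \<Rightarrow> complex) operator" where
  "fibre_operator V \<phi> k = Operator {f \<in> ell2 V. fibre_sum V \<phi> k f \<in> ell2 V} (fibre_sum V \<phi> k)"

lemma fibre_sum_scale: "fibre_sum V \<phi> k (\<lambda>v. c * f v) = (\<lambda>v. c * fibre_sum V \<phi> k f v)"
  by (auto simp: fibre_sum_def fun_eq_iff mult.left_commute[of _ c] infsum_cmult_right')

lemma fibre_sum_cong:
  assumes "\<And>v. v \<in> V \<Longrightarrow> \<phi> v \<noteq> None \<Longrightarrow> f v = g v"
  shows "fibre_sum V \<phi> k f = fibre_sum V \<phi> k g"
  using assms by (auto simp: fibre_sum_def fun_eq_iff intro!: infsum_cong)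

lemma fibre_sum_zero: "fibre_sum V \<phi> k 0 = 0"
  by (auto simp: fibre_sum_def fun_eq_iff)

text \<open>The fibres must be finite because the weights are arbitrary: over an infinite fibre the
  sum of two families could converge without either of them converging.\<close>

lemma fibre_sum_add:
  assumes "\<And>w. finite {v \<in> V. \<phi> v = Some w}"
  shows "fibre_sum V \<phi> k (f + g) = fibre_sum V \<phi> k f + fibre_sum V \<phi> k g"
  using assms by (auto simp: fibre_sum_def fun_eq_iff algebra_simps sum.distrib)

lemma linear_fibre_operator:
  assumes fin: "\<And>w. finite {v \<in> V. \<phi> v = Some w}"
  shows "linear_operator_in (ell2 V) (fibre_operator V \<phi> k)"
proof -
  have "cfun.subspace {f \<in> ell2 V. fibre_sum V \<phi> k f \<in> ell2 V}"
    using subspace_ell2[of V]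
    by (intro cfun.subspaceI)
      (auto simp: fibre_sum_zero fibre_sum_scale fibre_sum_add[OF fin] cfun.subspace_0
        intro: ell2_norm_add ell2_scale)
  then show ?thesis
    by (auto simp: linear_operator_in_def fibre_operator_def fibre_sum_scale fibre_sum_add[OF fin])
qed

text \<open>A function supported on a finite set \<open>F\<close> is sent to a function supported on the image of \<open>F\<close>,
  so it lies in the domain whatever the weights are.\<close>

lemma densely_defined_fibre_operator: "densely_defined V (fibre_operator V \<phi> k)"
proof -
  have "fibre_sum V \<phi> k f \<in> ell2 V" if F: "finite F" "\<And>v. f v \<noteq> 0 \<Longrightarrow> v \<in> F" for f F
  proof (rule ell2_finite_support)
    show "finite ((the \<circ> \<phi>) ` F)" using F(1) by simp
    fix w assume w: "fibre_sum V \<phi> k f w \<noteq> 0"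
    then have wV: "w \<in> V" by (auto simp: fibre_sum_def split: if_splits)
    have "\<exists>v. \<phi> v = Some w \<and> f v \<noteq> 0"
    proof (rule ccontr)
      assume "\<nexists>v. \<phi> v = Some w \<and> f v \<noteq> 0"
      then have "fibre_sum V \<phi> k f w = 0"
        by (auto simp: fibre_sum_def intro!: infsum_0)
      with w show False by simp
    qed
    then show "w \<in> (the \<circ> \<phi>) ` F \<inter> V" using F(2) wV by force
  qed
  then show ?thesis
    unfolding densely_defined_def fibre_operator_def
    by (intro dense_if_contains_finite_support) auto
qed

text \<open>If \<open>N\<close> avoids both the domain and the range of the partial map, the coordinates in \<open>N\<close> are
  neither read nor written by the operator. The functions supported on \<open>N\<close> then split off as an
  orthogonal summand on which the operator is zero.\<close>

lemma large_null_summand_fibre_operator: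
  assumes fin: "\<And>w. finite {v \<in> V. \<phi> v = Some w}"
    and N: "infinite N" "N \<subseteq> V"
    and undef: "\<And>v. v \<in> N \<Longrightarrow> \<phi> v = None"
    and avoid: "\<And>v w. v \<in> V \<Longrightarrow> \<phi> v = Some w \<Longrightarrow> w \<notin> N"
  shows "has_large_null_summand V (fibre_operator V \<phi> k)"
proof -
  let ?L = "fibre_sum V \<phi> k" and ?T = "fibre_operator V \<phi> k"
  let ?M = "supported_on V N"
  define D1 where "D1 = supported_on V (V - N) \<inter> op_dom ?T"
  have domT: "op_dom ?T = {f \<in> ell2 V. ?L f \<in> ell2 V}" and appT: "op_app ?T = ?L"
    by (simp_all add: fibre_operator_def)
  have L_M: "?L f = 0" if "f \<in> ?M" for f
  proof -
    have "?L f = ?L 0"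
      by (rule fibre_sum_cong) (use that undef in \<open>force simp: supported_on_def\<close>)
    then show ?thesis by (simp add: fibre_sum_zero)
  qed
  have L_add: "?L (f + g) = ?L g" if "f \<in> ?M" for f g
    by (simp add: fibre_sum_add[OF fin] L_M[OF that])
  have zero: "0 \<in> ell2 V" by (rule cfun.subspace_0[OF subspace_ell2])
  have L_range: "?L f \<in> supported_on V (V - N)" if "f \<in> op_dom ?T" for f
  proof -
    have "?L f w = 0" if "w \<in> N" for w
    proof -
      have empty: "{v \<in> V. \<phi> v = Some w} = {}" using avoid that by auto
      show ?thesis unfolding fibre_sum_def empty by simp
    qed
    moreover have "?L f w = 0" if "w \<notin> V" for w
      using that by (simp add: fibre_sum_def)
    ultimately show ?thesis
      using that by (auto simp: supported_on_def domT)
  qed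
  have lin0: "linear_operator_in ?M (Operator ?M (\<lambda>_. 0))"
    using subspace_supported_on[of V N] cfun.subspace_0[OF subspace_supported_on[of V N]]
    by (auto simp: linear_operator_in_def fun_eq_iff)
  have linT: "linear_operator_in (ell2 V) ?T" by (rule linear_fibre_operator[OF fin])
  have "cfun.subspace D1"
    unfolding D1_def
    by (rule cfun.subspace_inter[OF subspace_supported_on])
      (use linT in \<open>simp add: linear_operator_in_def\<close>)
  then have lin1: "linear_operator_in (supported_on V (V - N)) (Operator D1 ?L)"
    using L_range
    by (auto simp: linear_operator_in_def D1_def fibre_sum_scale fibre_sum_add[OF fin])
  have "op_dom ?T = {f + g |f g. f \<in> ?M \<and> g \<in> D1}"
  proof (intro set_eqI iffI)
    fix h assume h: "h \<in> op_dom ?T"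
    define f where "f = (\<lambda>v. if v \<in> N then h v else 0)"
    define g where "g = (\<lambda>v. if v \<in> V - N then h v else 0)"
    have hE: "h \<in> ell2 V" using h by (simp add: domT)
    have fE: "f \<in> ell2 V" and gE: "g \<in> ell2 V"
      unfolding f_def g_def by (rule ell2_support_subset[OF hE])+
    have fM: "f \<in> ?M" using fE by (auto simp: supported_on_def f_def)
    have hfg: "h = f + g"
      using hE N(2) by (auto simp: fun_eq_iff f_def g_def ell2_def)
    have "?L g \<in> ell2 V" using h L_add[OF fM, of g] by (simp add: hfg domT)
    then have "g \<in> D1"
      using gE by (auto simp: D1_def domT supported_on_def g_def)
    then show "h \<in> {f + g |f g. f \<in> ?M \<and> g \<in> D1}" using fM hfg by blast
  next
    fix h assume "h \<in> {f + g |f g. f \<in> ?M \<and> g \<in> D1}"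
    then obtain f g where "h = f + g" "f \<in> ?M" "g \<in> D1" by blast
    then show "h \<in> op_dom ?T"
      using L_add[of f g] by (auto simp: D1_def domT supported_on_def intro: ell2_norm_add)
  qed
  then have sum: "is_orth_sum ?T (Operator ?M (\<lambda>_. 0)) (Operator D1 ?L)"
    using L_add by (simp add: is_orth_sum_def appT)
  have "reducing_subspace V ?T ?M"
    unfolding reducing_subspace_def orth_compl_supported_on[OF N(2)]
    using subspace_supported_on closedin_supported_on lin0 lin1 sum by blast
  moreover have "?M \<subseteq> op_kernel ?T"
    using L_M zero by (auto simp: op_kernel_def domT appT supported_on_def)
  ultimately show ?thesis
    unfolding has_large_null_summand_def
    using linT densely_defined_fibre_operator infinite_dimensional_supported_on[OF N] by blast
qed


section \<open>Ancestors in a directed tree\<close>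

abbreviation (input) comparable :: "('a \<times> 'a) set \<Rightarrow> 'a \<Rightarrow> 'a \<Rightarrow> bool" where
  "comparable E x y \<equiv> (x, y) \<in> E\<^sup>* \<or> (y, x) \<in> E\<^sup>*"

lemma parent_unique:
  assumes "directed_tree V E" "(x, z) \<in> E" "(y, z) \<in> E"
  shows "x = y"
  using assms unfolding directed_tree_def by blast

lemma ancestors_comparable:
  assumes T: "directed_tree V E" and "(x, z) \<in> E\<^sup>*" "(y, z) \<in> E\<^sup>*"
  shows "comparable E x y"
  using assms(2,3)
proof (induction rule: rtrancl_induct)
  case base
  then show ?case by blast
next
  case (step z z')
  show ?case using step.prems
  proof (cases rule: rtranclE)
    case base
    then show ?thesis using step.hyps by (auto intro: rtrancl_into_rtrancl)
  next
    case (step p)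
    then show ?thesis using parent_unique[OF T] step.hyps \<open>(z, z') \<in> E\<close> \<open>(y, z) \<in> E\<^sup>* \<Longrightarrow> _\<close> by metis
  qed
qed

lemma par_SomeD: "par E v = Some w \<Longrightarrow> (w, v) \<in> E"
  by (auto simp: par_def split: if_splits intro: theI')

lemma par_iter_imp_ancestor: "par_iter E n v = Some w \<Longrightarrow> (w, v) \<in> E\<^sup>*"
proof (induction n arbitrary: w)
  case 0
  then show ?case by (simp add: par_iter_def)
next
  case (Suc n)
  then obtain x where x: "par_iter E n v = Some x" "par E x = Some w"
    by (auto simp: par_iter_def Option.bind_eq_Some_conv)
  show ?case
    by (rule converse_rtrancl_into_rtrancl[OF par_SomeD[OF x(2)] Suc.IH[OF x(1)]])
qed

lemma Asc_imp_trancl: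
  assumes "w \<in> Asc E v"
  shows "(w, v) \<in> E\<^sup>+"
proof -
  obtain n where "par_iter E (Suc n) v = Some w"
    using assms unfolding Asc_def by (auto simp: Suc_le_eq gr0_conv_Suc)
  then obtain x where x: "par_iter E n v = Some x" "par E x = Some w"
    by (auto simp: par_iter_def Option.bind_eq_Some_conv)
  show ?thesis
    by (rule rtrancl_into_trancl2[OF par_SomeD[OF x(2)] par_iter_imp_ancestor[OF x(1)]])
qed

lemma par_iter_add:
  assumes "par_iter E n x = Some y"
  shows "par_iter E (n + k) x = par_iter E k y"
  using assms by (simp add: par_iter_def funpow_add add.commute[of n k])

text \<open>The set of ancestors changes by at most one point along an edge, so whether it is finite does
  not change along an edge in either direction. It is finite at the root, and the tree is
  connected.\<close>

lemma finite_ancestors: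
  assumes T: "directed_tree V E" and R: "rooted V E" and "v \<in> V"
  shows "finite {x. (x, v) \<in> E\<^sup>*}"
proof -
  obtain r where r: "is_root V E r" using R unfolding rooted_def by blast
  have edge: "{x. (x, z) \<in> E\<^sup>*} = insert z {x. (x, y) \<in> E\<^sup>*}" if "(y, z) \<in> E" for y z
  proof -
    have "x = z \<or> (x, y) \<in> E\<^sup>*" if "(x, z) \<in> E\<^sup>*" for x
      using that parent_unique[OF T \<open>(y, z) \<in> E\<close>] by (metis rtrancl.cases)
    then show ?thesis using that by (auto intro: rtrancl_into_rtrancl)
  qed
  have "(r, v) \<in> (E \<union> E\<inverse>)\<^sup>*"
    using T r assms(3) unfolding directed_tree_def is_root_def by blast
  then show ?thesis
  proof (induction rule: rtrancl_induct)
    case base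
    have "x = r" if "(x, r) \<in> E\<^sup>*" for x
      using that r unfolding is_root_def by (metis rtranclE)
    then have "{x. (x, r) \<in> E\<^sup>*} = {r}" by auto
    then show ?case by simp
  next
    case (step y z)
    then consider "(y, z) \<in> E" | "(z, y) \<in> E" by blast
    then show ?case
    proof cases
      case 1
      then show ?thesis using step.IH by (simp add: edge)
    next
      case 2
      then show ?thesis using step.IH by (simp add: edge)
    qed
  qed
qed

text \<open>A nonempty finite acyclic graph has a sink, which a leafless tree forbids.\<close>

lemma infinite_Des:
  assumes T: "directed_tree V E" and L: "leafless V E" and "c \<in> V"
  shows "infinite (Des E c)"
proof
  assume fin: "finite (Des E c)"
  let ?R = "E \<inter> Des E c \<times> Des E c"
  have "wf (?R\<inverse>)"
  proof (rule finite_acyclic_wf_converse)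
    show "finite ?R" using fin by simp
    show "acyclic ?R"
      using T by (auto simp: directed_tree_def intro: acyclic_subset)
  qed
  moreover have "c \<in> Des E c" by (simp add: Des_def)
  ultimately obtain z where z: "z \<in> Des E c" "\<And>y. (y, z) \<in> ?R\<inverse> \<Longrightarrow> y \<notin> Des E c"
    by (rule wfE_min) blast
  have "z \<in> V"
    using z(1) assms(3) T unfolding Des_def directed_tree_def by (auto elim: rtranclE)
  then obtain y where y: "(z, y) \<in> E" using L unfolding leafless_def by blast
  then have "y \<in> Des E c" using z(1) by (auto simp: Des_def intro: rtrancl_into_rtrancl)
  then show False using z y by blast
qed

text \<open>Two children of a proper ancestor \<open>w\<close> of \<open>u\<close> cannot both lie on the path from \<open>w\<close> to \<open>u\<close>,
  so some child \<open>c\<close> starts a branch that misses this path. Any vertex below \<open>c\<close> that were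
  comparable to \<open>u\<close> would make \<open>c\<close> comparable to \<open>u\<close>.\<close>

lemma infinite_incomparable:
  assumes T: "directed_tree V E" and L: "leafless V E"
    and w: "w \<in> Asc E u" "branching_vertex V E w"
  shows "infinite {v \<in> V. \<not> comparable E u v}"
proof -
  have acyc: "acyclic E" and EV: "E \<subseteq> V \<times> V" using T by (auto simp: directed_tree_def)
  have no_back: "(c, w) \<notin> E\<^sup>*" if "(w, c) \<in> E" for c
    using acyc that by (meson acyclic_def rtrancl_into_trancl2)
  have sibling: "(c, c') \<notin> E\<^sup>*" if c: "(w, c) \<in> E" "(w, c') \<in> E" "c \<noteq> c'" for c c'
  proof
    assume "(c, c') \<in> E\<^sup>*"
    then obtain p where "(c, p) \<in> E\<^sup>*" "(p, c') \<in> E" using c(3) by (auto elim: rtranclE)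
    then show False using parent_unique[OF T] c no_back by blast
  qed
  obtain c1 c2 where c12: "c1 \<noteq> c2" "(w, c1) \<in> E" "(w, c2) \<in> E"
    using w(2) unfolding branching_vertex_def by blast
  have "\<not> ((c1, u) \<in> E\<^sup>* \<and> (c2, u) \<in> E\<^sup>*)"
    using ancestors_comparable[OF T] sibling c12 by metis
  then obtain c where c: "(w, c) \<in> E" "(c, u) \<notin> E\<^sup>*" using c12 by blast
  have "(u, c) \<notin> E\<^sup>*"
  proof
    assume "(u, c) \<in> E\<^sup>*"
    moreover have "u \<noteq> c" using c(2) by auto
    ultimately obtain p where "(u, p) \<in> E\<^sup>*" "(p, c) \<in> E" by (auto elim: rtranclE)
    then have "(u, w) \<in> E\<^sup>*" using parent_unique[OF T c(1)] by blast
    then show False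
      using Asc_imp_trancl[OF w(1)] acyc by (meson acyclic_def rtrancl_trancl_trancl)
  qed
  then have "\<not> comparable E u v" if "(c, v) \<in> E\<^sup>*" for v
    using that c(2) ancestors_comparable[OF T, of u v c] by (auto dest: rtrancl_trans)
  moreover have "v \<in> V" if "(c, v) \<in> E\<^sup>*" for v
    using that c(1) EV by (auto elim: rtranclE)
  ultimately have "Des E c \<subseteq> {v \<in> V. \<not> comparable E u v}"
    unfolding Des_def by blast
  moreover have "infinite (Des E c)" using infinite_Des[OF T L] c(1) EV by blast
  ultimately show ?thesis using finite_subset by blast
qed


section \<open>Values of the join operations\<close>

lemma ext_edges_rtranclD: "(Some x, Some y) \<in> (ext_edges V E)\<^sup>* \<Longrightarrow> (x, y) \<in> E\<^sup>*"
proof -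
  have "z = Some y \<Longrightarrow> (x, y) \<in> E\<^sup>*" if "(Some x, z) \<in> (ext_edges V E)\<^sup>*" for y z
    using that
  proof (induction arbitrary: y rule: rtrancl_induct)
    case (step z z')
    then show ?case by (auto simp: ext_edges_def intro: rtrancl_into_rtrancl)
  qed auto
  then show "(Some x, Some y) \<in> (ext_edges V E)\<^sup>* \<Longrightarrow> (x, y) \<in> E\<^sup>*" by blast
qed

text \<open>The vertices \<open>u\<close> and \<open>v\<close> lie on the path from the root to \<open>b\<close>, so one of them is a common
  ancestor of both. As a vertex has finitely many ancestors, a common ancestor of largest depth
  exists.\<close>

lemma meet_ancestor:
  assumes T: "directed_tree V E" and R: "rooted V E" and V: "u \<in> V" "v \<in> V"
    and b: "u \<in> Asc E b" "v \<in> Asc E b"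
  shows "(meet V E u v, u) \<in> E\<^sup>*"
proof -
  let ?P = "\<lambda>w. w \<in> V \<and> (\<exists>n m. par_iter E n u = Some w \<and> par_iter E m v = Some w)"
  have self: "par_iter E 0 x = Some x" for x by (simp add: par_iter_def)
  obtain i j where ij: "par_iter E i b = Some u" "par_iter E j b = Some v"
    using b unfolding Asc_def by blast
  have "\<exists>w. ?P w"
  proof (cases "i \<le> j")
    case True
    then have "par_iter E (j - i) u = Some v" using par_iter_add[OF ij(1), of "j - i"] ij by simp
    then show ?thesis using V self by blast
  next
    case False
    then have "par_iter E (i - j) v = Some u" using par_iter_add[OF ij(2), of "i - j"] ij by simp
    then show ?thesis using V self by blast
  qed
  then obtain w where w: "?P w" ..
  have sub: "Collect ?P \<subseteq> {x. (x, u) \<in> E\<^sup>*}" using par_iter_imp_ancestor by fast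
  have "finite (depth V E ` Collect ?P)"
    using finite_subset[OF sub finite_ancestors[OF T R V(1)]] by simp
  then obtain B where "\<forall>x\<in>depth V E ` Collect ?P. x < B"
    using finite_nat_set_iff_bounded by blast
  then have bound: "\<forall>x. ?P x \<longrightarrow> depth V E x < B" by blast
  have "?P (meet V E u v)" unfolding meet_def by (rule arg_max_natI[where P = ?P, OF w bound])
  then show ?thesis using sub by blast
qed

text \<open>In each case of the definition a finite value arises only along a path through \<open>u\<close>: two
  ancestors of \<open>b\<close> lie on one path, and the plain join of incomparable vertices is \<open>\<infinity>\<close>. The argument
  \<open>b\<close> is exceptional, being sent to \<open>u\<close> wherever it lies. The last clause bounds the fibres: a
  value determines its argument unless the argument is \<open>u\<close>, \<open>b\<close> or an ancestor of one of them.\<close>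

lemma join_at_SomeD:
  assumes T: "directed_tree V E" and R: "rooted V E" and V: "u \<in> V" "v \<in> V" and "b \<noteq> u"
    and eq: "join_at V E b (Some u) (Some v) = Some w"
  shows "comparable E u w" and "v = b \<or> comparable E u v"
    and "v = w \<or> (v, u) \<in> E\<^sup>* \<or> (v, b) \<in> E\<^sup>*"
proof -
  have "comparable E u w \<and> (v = b \<or> comparable E u v) \<and> (v = w \<or> (v, u) \<in> E\<^sup>* \<or> (v, b) \<in> E\<^sup>*)"
  proof (cases "u \<in> Asc E b \<and> v \<in> Asc E b")
    case True
    then have "w = meet V E u v" using eq by (simp add: join_at_def)
    then have "(w, u) \<in> E\<^sup>*" using meet_ancestor[OF T R V, of b] True by simp
    moreover have "(u, b) \<in> E\<^sup>*" "(v, b) \<in> E\<^sup>*"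
      using True by (simp_all add: Asc_imp_trancl trancl_into_rtrancl)
    ultimately show ?thesis using ancestors_comparable[OF T] by metis
  next
    case outside: False
    show ?thesis
    proof (cases "v = b")
      case True
      then have "w = u" using eq outside by (auto simp: join_at_def split: if_splits)
      then show ?thesis using True by simp
    next
      case False
      then have "join V E (Some u) (Some v) = Some w"
        using eq outside \<open>b \<noteq> u\<close> by (auto simp: join_at_def split: if_splits)
      then show ?thesis
        by (auto simp: join_def Des_def split: if_splits dest: ext_edges_rtranclD)
    qed
  qed
  then show "comparable E u w" "v = b \<or> comparable E u v"
    "v = w \<or> (v, u) \<in> E\<^sup>* \<or> (v, b) \<in> E\<^sup>*" by blast+
qed

theorem corollary3p15:
  fixes V :: "'a set" and E :: "('a \<times> 'a) set" and u b :: 'a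
    and l :: "'a option \<Rightarrow> complex"
  assumes "directed_tree V E" and "countable V" and "infinite V"
    and "rooted V E" and "leafless V E"
    and "u \<in> V" and "b \<in> V - {u}"
    and "weight_system l"
    and "\<exists>w \<in> Asc E u. branching_vertex V E w"
  shows "has_large_null_summand V (weighted_join_operator V E b u l)"
proof -
  note T = assms(1) and R = assms(4)
  have b: "b \<in> V" "b \<noteq> u" using assms(7) by auto
  let ?\<phi> = "\<lambda>v. join_at V E b (Some u) (Some v)"
  note D = join_at_SomeD[OF T R \<open>u \<in> V\<close> _ b(2)]
  \<comment> \<open>The vertex \<open>b\<close> is sent to \<open>u\<close>, so it has to be left out even when it is incomparable to \<open>u\<close>.\<close>
  define N where "N = {v \<in> V. \<not> comparable E u v} - {b}"
  have "has_large_null_summand V (fibre_operator V ?\<phi> (\<lambda>v. l (Some v)))"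
  proof (rule large_null_summand_fibre_operator)
    fix w
    have "{v \<in> V. ?\<phi> v = Some w} \<subseteq> insert w ({x. (x, u) \<in> E\<^sup>*} \<union> {x. (x, b) \<in> E\<^sup>*})"
      using D(3) by blast
    then show "finite {v \<in> V. ?\<phi> v = Some w}"
      by (rule finite_subset)
        (use finite_ancestors[OF T R] \<open>u \<in> V\<close> b(1) in simp)
  next
    show "infinite N"
      unfolding N_def using infinite_incomparable[OF T assms(5)] assms(9) by auto
    show "N \<subseteq> V" by (auto simp: N_def)
    show "?\<phi> v = None" if "v \<in> N" for v
      using that D(2)[of v] by (cases "?\<phi> v") (auto simp: N_def)
    show "w \<notin> N" if "v \<in> V" "?\<phi> v = Some w" for v w
      using D(1)[OF that] by (auto simp: N_def)
  qed
  moreover have "weighted_join_operator V E b u l = fibre_operator V ?\<phi> (\<lambda>v. l (Some v))"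
    by (simp add: weighted_join_operator_def fibre_operator_def Lambda_join_def fibre_sum_def
        fun_eq_iff)
  ultimately show ?thesis by simp
qed

end
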